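(* If $\Gamma_f$ is a coassociative graph, then it has no $J_0$-complex points.
   Context: On $\mathbb R^8=\mathbb R^4\times\mathbb R^4$ with Euclidean metric $g_0$, let $J_0(X,Y)=(-Y,X)$. For a smooth map $f:\mathbb R^4\to\mathbb R^4$ its graph is $\Gamma_f:\mathbb R^4\to\mathbb R^8$, $\Gamma_f(x)=(x,f(x))$. A coassociative graph is the graph $\Gamma_f$ of a smooth map $f:\mathbb R^4\to\mathbb R^3\subset\mathbb R^4$ (where $\mathbb R^3=\mathrm{Im}\,\mathbb H$, $\mathbb R^4=\mathbb H$) that is a Cayley submanifold of $\mathbb R^8$ (calibrated by the Cayley calibration of Harvey and Lawson). A point $p$ is a $J_0$-complex point of $\Gamma_f$ if the tangent space $\{(X,df_p(X)):X\in\mathbb R^4\}$ is $J_0$-invariant. *)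

theory Defs
  imports "HOL-Analysis.Analysis"
begin

section \<open>Smooth maps\<close>

text \<open>
  Since all spaces here are finite-dimensional, a map is of class $C^{k+1}$ iff it is (Frechet)
  differentiable and each of its directional derivatives is of class $C^k$.
\<close>

primrec times_cont_diff ::
  "nat \<Rightarrow> ('a::euclidean_space \<Rightarrow> 'b::euclidean_space) \<Rightarrow> bool" where
  "times_cont_diff 0 f \<longleftrightarrow> continuous_on UNIV f"
| "times_cont_diff (Suc k) f \<longleftrightarrow>
     (\<forall>x. f differentiable (at x)) \<and>
     (\<forall>v. times_cont_diff k (\<lambda>x. frechet_derivative f (at x) v))"

definition smooth_map :: "('a::euclidean_space \<Rightarrow> 'b::euclidean_space) \<Rightarrow> bool" where
  "smooth_map f \<longleftrightarrow> (\<forall>k. times_cont_diff k f)"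

section \<open>Quaternions and octonions\<close>

text \<open>
  The quaternion $a + bi + cj + dk$ is the vector $(a,b,c,d)$.
\<close>

type_synonym quat = "real^4"

definition quat_mult :: "quat \<Rightarrow> quat \<Rightarrow> quat" where
  "quat_mult p q = vector
     [p$1 * q$1 - p$2 * q$2 - p$3 * q$3 - p$4 * q$4,
      p$1 * q$2 + p$2 * q$1 + p$3 * q$4 - p$4 * q$3,
      p$1 * q$3 - p$2 * q$4 + p$3 * q$1 + p$4 * q$2,
      p$1 * q$4 + p$2 * q$3 - p$3 * q$2 + p$4 * q$1]"

definition quat_cnj :: "quat \<Rightarrow> quat" where
  "quat_cnj q = vector [q$1, - q$2, - q$3, - q$4]"

definition Im_quat :: "quat set" where
  "Im_quat = {q. q$1 = 0}"

text \<open>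
  The octonions are obtained from the quaternions by the Cayley--Dickson process, with the
  conventions of Harvey and Lawson: the pair $(a,b)$ stands for $a + be$, and
  $(a + be)(c + de) = (ac - \bar d b) + (da + b \bar c)e$.  The inner product and norm of the
  product type are the Euclidean ones of $\mathbb{R}^8$.
\<close>

type_synonym oct = "quat \<times> quat"

definition oct_mult :: "oct \<Rightarrow> oct \<Rightarrow> oct" where
  "oct_mult x y =
     (quat_mult (fst x) (fst y) - quat_mult (quat_cnj (snd y)) (snd x),
      quat_mult (snd y) (fst x) + quat_mult (snd x) (quat_cnj (fst y)))"

definition oct_cnj :: "oct \<Rightarrow> oct" where
  "oct_cnj x = (quat_cnj (fst x), - snd x)"

section \<open>The Cayley calibration\<close>

text \<open>
  Triple cross product $x \times y \times z = \frac12 (x(\bar y z) - z(\bar y x))$ and Cayley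
  4-form $\Phi(x,y,z,w) = \langle x, y \times z \times w\rangle$ of Harvey and Lawson.
\<close>

definition oct_cross :: "oct \<Rightarrow> oct \<Rightarrow> oct \<Rightarrow> oct" where
  "oct_cross x y z =
     (1/2) *\<^sub>R (oct_mult x (oct_mult (oct_cnj y) z) - oct_mult z (oct_mult (oct_cnj y) x))"

definition cayley_form :: "oct \<Rightarrow> oct \<Rightarrow> oct \<Rightarrow> oct \<Rightarrow> real" where
  "cayley_form x y z w = x \<bullet> oct_cross y z w"

text \<open>
  A 4-plane is calibrated if the Cayley form restricts to the volume form of one of its two
  orientations, i.e. takes the value 1 on some orthonormal basis.
\<close>

definition cayley_plane :: "oct set \<Rightarrow> bool" where
  "cayley_plane T \<longleftrightarrow>
     (\<exists>a b c d. norm a = 1 \<and> norm b = 1 \<and> norm c = 1 \<and> norm d = 1 \<and>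
        a \<bullet> b = 0 \<and> a \<bullet> c = 0 \<and> a \<bullet> d = 0 \<and> b \<bullet> c = 0 \<and> b \<bullet> d = 0 \<and> c \<bullet> d = 0 \<and>
        span {a, b, c, d} = T \<and> cayley_form a b c d = 1)"

section \<open>Graphs\<close>

definition graph_map :: "(quat \<Rightarrow> quat) \<Rightarrow> quat \<Rightarrow> oct" where
  "graph_map f x = (x, f x)"

definition graph_tangent :: "(quat \<Rightarrow> quat) \<Rightarrow> quat \<Rightarrow> oct set" where
  "graph_tangent f p = {(X, frechet_derivative f (at p) X) | X. True}"

lemma graph_tangent_eq_range:
  assumes "f differentiable (at p)"
  shows "graph_tangent f p = range (frechet_derivative (graph_map f) (at p))"
proof -
  have "(f has_derivative frechet_derivative f (at p)) (at p)"
    using assms by (simp add: frechet_derivative_works)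
  then have "(graph_map f has_derivative (\<lambda>X. (X, frechet_derivative f (at p) X))) (at p)"
    unfolding graph_map_def by (intro has_derivative_Pair has_derivative_ident)
  then have "frechet_derivative (graph_map f) (at p) = (\<lambda>X. (X, frechet_derivative f (at p) X))"
    by (rule frechet_derivative_at[symmetric])
  then show ?thesis
    by (auto simp: graph_tangent_def)
qed

text \<open>
  The graph of a smooth map is automatically an embedded submanifold, so being a Cayley
  submanifold is a condition on its tangent planes.  Their Cayley orientations fit together,
  because the (continuous) restriction of the Cayley form to the graph then has no zeros.
\<close>

definition cayley_graph :: "(quat \<Rightarrow> quat) \<Rightarrow> bool" where
  "cayley_graph f \<longleftrightarrow> smooth_map f \<and> (\<forall>p. cayley_plane (graph_tangent f p))"

definition coassociative_graph :: "(quat \<Rightarrow> quat) \<Rightarrow> bool" where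
  "coassociative_graph f \<longleftrightarrow> range f \<subseteq> Im_quat \<and> cayley_graph f"

definition J0 :: "oct \<Rightarrow> oct" where
  "J0 v = (- snd v, fst v)"

definition J0_complex_point :: "(quat \<Rightarrow> quat) \<Rightarrow> quat \<Rightarrow> bool" where
  "J0_complex_point f p \<longleftrightarrow> J0 ` graph_tangent f p \<subseteq> graph_tangent f p"

end

theory Submission
  imports Defs
begin

text \<open>Let L be the derivative of f at a complex point p. The tangent space is the graph of L,
  and its invariance under \<open>J0\<close> forces L(-LX) = X for every X, so L is onto. But f
  takes values in the hyperplane \<open>Im_quat\<close>, hence so does L: a contradiction.\<close>

lemma smooth_map_differentiable:
  assumes "smooth_map f"
  shows "f differentiable (at p)"
proof -
  have "times_cont_diff (Suc 0) f"
    using assms unfolding smooth_map_def by blast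
  then show ?thesis
    by simp
qed

text \<open>The first coordinate of f is identically zero, so by uniqueness of derivatives its
  derivative, the first coordinate of that of f, vanishes.\<close>

lemma range_frechet_derivative_Im_quat:
  assumes "f differentiable (at p)" and "range f \<subseteq> Im_quat"
  shows "range (frechet_derivative f (at p)) \<subseteq> Im_quat"
proof -
  have "((\<lambda>x. f x $ 1) has_derivative (\<lambda>X. frechet_derivative f (at p) X $ 1)) (at p)"
    using assms(1) by (intro bounded_linear.has_derivative[OF bounded_linear_vec_nth])
      (simp add: frechet_derivative_works)
  moreover have "(\<lambda>x. f x $ 1) = (\<lambda>x. 0)"
    using assms(2) by (auto simp: Im_quat_def)
  ultimately have "(\<lambda>X. frechet_derivative f (at p) X $ 1) = (\<lambda>X. 0)"
    using has_derivative_unique[OF _ has_derivative_const] by metis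
  then show ?thesis
    by (auto simp: Im_quat_def dest: fun_cong)
qed

text \<open>With L the derivative, \<open>J0\<close> sends (X, LX) to (-LX, X). A graph contains
  this pair only if L maps -LX to X, which exhibits a preimage of X.\<close>

lemma J0_complex_point_frechet_derivative_surj:
  assumes "J0_complex_point f p"
  shows "surj (frechet_derivative f (at p))"
proof (rule surjI)
  fix X
  have "J0 (X, frechet_derivative f (at p) X) \<in> graph_tangent f p"
    using assms unfolding J0_complex_point_def graph_tangent_def by blast
  then show "frechet_derivative f (at p) (- frechet_derivative f (at p) X) = X"
    by (simp add: J0_def graph_tangent_def)
qed

theorem corollary8p4:
  fixes f :: "real^4 \<Rightarrow> real^4"
  assumes "coassociative_graph f"
  shows "\<not> (\<exists>p. J0_complex_point f p)"
proof
  assume "\<exists>p. J0_complex_point f p"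
  then obtain p where "J0_complex_point f p"
    by blast
  then have "surj (frechet_derivative f (at p))"
    by (rule J0_complex_point_frechet_derivative_surj)
  moreover have "range (frechet_derivative f (at p)) \<subseteq> Im_quat"
    using assms
    by (intro range_frechet_derivative_Im_quat smooth_map_differentiable)
      (auto simp: coassociative_graph_def cayley_graph_def)
  \<comment> \<open>In \<open>real^4\<close> the constant \<open>1\<close> is the vector (1,1,1,1),
    not the quaternion unit; all that matters is that its first coordinate is nonzero.\<close>
  ultimately have "(1 :: quat) \<in> Im_quat"
    by blast
  then show False
    by (simp add: Im_quat_def)
qed

end
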